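(* The map $p:\mathcal{F}\to\mathcal{C}$, $f\mapsto C^f$, is surjective.
   Context: $\mathbb{Z}_{\le 0}$ denotes the nonpositive integers. $\mathcal{F}$ is the set of nowhere-vanishing functions $f:\mathbb{Z}_{\le 0}^3\to\mathbb{C}$ satisfying the cube recurrence: for all $(i,j,k)\in\mathbb{Z}_{\le 0}^3$, $$f_{i,j,k}f_{i-1,j-1,k-1}=f_{i-1,j,k}f_{i,j-1,k-1}+f_{i,j-1,k}f_{i-1,j,k-1}+f_{i,j,k-1}f_{i-1,j-1,k}.$$ A conductance function $C$ consists of nonzero complex numbers $C_q(i,j,k)$, $q\in\{a,b,c\}$, $(i,j,k)\in\mathbb{Z}_{\le 0}^3$; write $c_q(i,j,k)=1/C_q(i,j,k)$. It is $Y$-$\Delta$ consistent if for all $(i,j,k)\in\mathbb{Z}_{\le 0}^3$ the three quantities $$C_a(i,j,k)c_a(i-1,j,k),\quad C_b(i,j,k)c_b(i,j-1,k),\quad C_c(i,j,k)c_c(i,j,k-1)$$ are all equal to $C_a(i,j,k)C_b(i,j,k)+C_a(i,j,k)C_c(i,j,k)+C_b(i,j,k)C_c(i,j,k)$. $\mathcal{C}$ is the set of $Y$-$\Delta$ consistent conductance functions. For $f\in\mathcal{F}$, $C^f$ is the conductance function $$C^f_a(i,j,k)=\frac{f_{i,j-1,k}f_{i,j,k-1}}{f_{i,j,k}f_{i,j-1,k-1}},\quad C^f_b(i,j,k)=\frac{f_{i-1,j,k}f_{i,j,k-1}}{f_{i,j,k}f_{i-1,j,k-1}},\quad C^f_c(i,j,k)=\frac{f_{i-1,j,k}f_{i,j-1,k}}{f_{i,j,k}f_{i-1,j-1,k}},$$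 which is $Y$-$\Delta$ consistent (a known fact). *)

theory Defs
  imports Complex_Main "HOL-Library.FuncSet"
begin

definition octant :: "(int \<times> int \<times> int) set" where
  "octant = {..0} \<times> {..0} \<times> {..0}"

text \<open>
  Functions with domain \<open>octant\<close> are represented by total functions that are extensional on
  \<open>octant\<close> (equal to \<open>undefined\<close> elsewhere), so that equality in HOL is equality of functions on
  \<open>octant\<close>. All defining equations below only evaluate them at points of \<open>octant\<close>.
\<close>

definition cube_functions :: "(int \<times> int \<times> int \<Rightarrow> complex) set" where
  "cube_functions = {f \<in> octant \<rightarrow>\<^sub>E (- {0}).
     \<forall>(i, j, k) \<in> octant.
       f (i, j, k) * f (i - 1, j - 1, k - 1) =
         f (i - 1, j, k) * f (i, j - 1, k - 1)
         + f (i, j - 1, k) * f (i - 1, j, k - 1)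
         + f (i, j, k - 1) * f (i - 1, j - 1, k)}"

datatype edge_label = Ea | Eb | Ec

type_synonym conductance = "edge_label \<Rightarrow> int \<times> int \<times> int \<Rightarrow> complex"

definition conductance_functions :: "conductance set" where
  "conductance_functions = {C. \<forall>q. C q \<in> octant \<rightarrow>\<^sub>E (- {0})}"

definition resistance :: "conductance \<Rightarrow> conductance" where
  "resistance C q x = 1 / C q x"

definition Y_Delta_consistent :: "conductance \<Rightarrow> bool" where
  "Y_Delta_consistent C \<longleftrightarrow>
     (\<forall>(i, j, k) \<in> octant.
        let S = C Ea (i, j, k) * C Eb (i, j, k) + C Ea (i, j, k) * C Ec (i, j, k)
                + C Eb (i, j, k) * C Ec (i, j, k)
        in C Ea (i, j, k) * resistance C Ea (i - 1, j, k) = S \<and>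
           C Eb (i, j, k) * resistance C Eb (i, j - 1, k) = S \<and>
           C Ec (i, j, k) * resistance C Ec (i, j, k - 1) = S)"

definition consistent_conductances :: "conductance set" where
  "consistent_conductances = {C \<in> conductance_functions. Y_Delta_consistent C}"

text \<open>The map \<open>p\<close>, sending \<open>f\<close> to \<open>C\<^sup>f\<close>.\<close>

definition conductance_of :: "(int \<times> int \<times> int \<Rightarrow> complex) \<Rightarrow> conductance" where
  "conductance_of f q = (\<lambda>(i, j, k) \<in> octant.
     case q of
       Ea \<Rightarrow> (f (i, j - 1, k) * f (i, j, k - 1)) / (f (i, j, k) * f (i, j - 1, k - 1))
     | Eb \<Rightarrow> (f (i - 1, j, k) * f (i, j, k - 1)) / (f (i, j, k) * f (i - 1, j, k - 1))
     | Ec \<Rightarrow> (f (i - 1, j, k) * f (i, j - 1, k)) / (f (i, j, k) * f (i - 1, j - 1, k)))"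

end

theory Submission imports Defs begin

text \<open>
  Reflect the octant to \<open>\<nat>\<^sup>3\<close> by negating coordinates, and put \<open>f = 1/u\<close>.  The equation
  \<open>C\<^sup>f = C\<close> then says that the three conductances of \<open>C\<close> are the mixed second differences of
  \<open>u\<close>, written multiplicatively: \<open>C\<^sub>a\<close> in the directions 2 and 3, \<open>C\<^sub>b\<close> in 1 and 3, \<open>C\<^sub>c\<close> in 1
  and 2.  A solution \<open>u\<close> forces the difference of \<open>C\<^sub>a\<close> in direction 1, of \<open>C\<^sub>b\<close> in direction 2
  and of \<open>C\<^sub>c\<close> in direction 3 to agree, each being the mixed third difference of \<open>u\<close>.  This
  necessary condition is the part of consistency saying that the three quantities coincide.  It
  is also sufficient: the function \<open>potential\<close> sums the data explicitly, and the compatibility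
  condition makes the sums telescope (\<open>potential_mixed_23\<close>, \<open>potential_mixed_13\<close>,
  \<open>potential_mixed_12\<close>).

  The rest of consistency, namely that the common value is \<open>C\<^sub>aC\<^sub>b + C\<^sub>aC\<^sub>c + C\<^sub>bC\<^sub>c\<close>, is for
  conductances of the form \<open>C\<^sup>f\<close> equivalent to the cube recurrence for \<open>f\<close> at that point
  (\<open>cube_recurrence_iff_Y_Delta\<close>).  One direction of this equivalence shows that the solution
  \<open>1/u\<close> lies in \<open>cube_functions\<close>; the other shows that \<open>C\<^sup>f\<close> is consistent.
\<close>

section \<open>Integrating mixed second differences\<close>

text \<open>
  A discrete fundamental theorem of calculus: the hypothesis says that the quotient
  \<open>a' n / a n\<close> is the increment of \<open>b\<close>.
\<close>

lemma prod_telescope_cross: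
  fixes a a' b :: "nat \<Rightarrow> 'a :: comm_monoid_mult"
  assumes "\<And>n. a n * b (Suc n) = a' n * b n"
  shows "(\<Prod>m<n. a' m) * b 0 = (\<Prod>m<n. a m) * b n"
proof (induction n)
  case 0
  show ?case by simp
next
  case (Suc n)
  have "(\<Prod>m<Suc n. a' m) * b 0 = ((\<Prod>m<n. a' m) * b 0) * a' n"
    by (simp add: ac_simps)
  also note Suc.IH
  also have "(\<Prod>m<n. a m) * b n * a' n = (\<Prod>m<n. a m) * (a' n * b n)"
    by (simp only: ac_simps)
  also have "\<dots> = (\<Prod>m<Suc n. a m) * b (Suc n)"
    by (simp add: assms [symmetric] ac_simps)
  finally show ?case .
qed

text \<open>
  The solution whose values on the three coordinate axes are 1.  On the coordinate planes it is
  the double product of the one conductance that lives there; away from them one would multiply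
  by the product of the third difference over a box, and that product telescopes in direction 1
  and moves the double product of \<open>A\<close> from the plane \<open>i = 0\<close> to the level \<open>i\<close>.
\<close>

definition potential ::
  "(nat \<Rightarrow> nat \<Rightarrow> nat \<Rightarrow> 'a) \<Rightarrow> (nat \<Rightarrow> nat \<Rightarrow> nat \<Rightarrow> 'a) \<Rightarrow> (nat \<Rightarrow> nat \<Rightarrow> nat \<Rightarrow> 'a)
    \<Rightarrow> nat \<Rightarrow> nat \<Rightarrow> nat \<Rightarrow> 'a :: comm_monoid_mult" where
  "potential A B C i j k =
     (\<Prod>j'<j. \<Prod>k'<k. A i j' k') * (\<Prod>i'<i. \<Prod>k'<k. B i' 0 k') * (\<Prod>i'<i. \<Prod>j'<j. C i' j' 0)"

lemma potential_nonzero: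
  fixes A B C :: "nat \<Rightarrow> nat \<Rightarrow> nat \<Rightarrow> 'a :: semidom"
  assumes "\<And>i j k. A i j k \<noteq> 0" "\<And>i j k. B i j k \<noteq> 0" "\<And>i j k. C i j k \<noteq> 0"
  shows "potential A B C i j k \<noteq> 0"
  using assms by (simp add: potential_def)

lemma potential_Suc_2:
  "potential A B C i (Suc j) k =
     potential A B C i j k * ((\<Prod>k'<k. A i j k') * (\<Prod>i'<i. C i' j 0))"
  by (simp add: potential_def prod.distrib ac_simps)

lemma potential_Suc_3:
  "potential A B C i j (Suc k) =
     potential A B C i j k * ((\<Prod>j'<j. A i j' k) * (\<Prod>i'<i. B i' 0 k))"
  by (simp add: potential_def prod.distrib ac_simps)

lemma potential_mixed_23:
  "potential A B C i j k * potential A B C i (Suc j) (Suc k) =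
     A i j k * (potential A B C i (Suc j) k * potential A B C i j (Suc k))"
  by (simp add: potential_def prod.distrib ac_simps)

text \<open>
  Summing the difference of \<open>A\<close> in direction 1 over \<open>j' < j\<close> is summing the difference of \<open>B\<close>
  in direction 2, which carries \<open>B\<close> from the plane \<open>j = 0\<close> to the level \<open>j\<close>.
\<close>

lemma potential_mixed_13:
  assumes "\<And>i j k. A i j k * B i (Suc j) k = A (Suc i) j k * B i j k"
  shows "potential A B C i j k * potential A B C (Suc i) j (Suc k) =
     B i j k * (potential A B C (Suc i) j k * potential A B C i j (Suc k))"
proof -
  define r where "r = potential A B C i j k * potential A B C (Suc i) j k * (\<Prod>i'<i. B i' 0 k)"
  have "potential A B C i j k * potential A B C (Suc i) j (Suc k) =
      ((\<Prod>j'<j. A (Suc i) j' k) * B i 0 k) * r"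
    by (simp only: r_def potential_Suc_3 prod.lessThan_Suc ac_simps)
  also have "(\<Prod>j'<j. A (Suc i) j' k) * B i 0 k = (\<Prod>j'<j. A i j' k) * B i j k"
    by (rule prod_telescope_cross) (rule assms)
  also have "\<dots> * r = B i j k * (potential A B C (Suc i) j k * potential A B C i j (Suc k))"
    by (simp only: r_def potential_Suc_3 ac_simps)
  finally show ?thesis .
qed

lemma potential_mixed_12:
  assumes "\<And>i j k. A i j k * C i j (Suc k) = A (Suc i) j k * C i j k"
  shows "potential A B C i j k * potential A B C (Suc i) (Suc j) k =
     C i j k * (potential A B C (Suc i) j k * potential A B C i (Suc j) k)"
proof -
  define r where "r = potential A B C i j k * potential A B C (Suc i) j k * (\<Prod>i'<i. C i' j 0)"
  have "potential A B C i j k * potential A B C (Suc i) (Suc j) k =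
      ((\<Prod>k'<k. A (Suc i) j k') * C i j 0) * r"
    by (simp only: r_def potential_Suc_2 prod.lessThan_Suc ac_simps)
  also have "(\<Prod>k'<k. A (Suc i) j k') * C i j 0 = (\<Prod>k'<k. A i j k') * C i j k"
    by (rule prod_telescope_cross) (rule assms)
  also have "\<dots> * r = C i j k * (potential A B C (Suc i) j k * potential A B C i (Suc j) k)"
    by (simp only: r_def potential_Suc_2 ac_simps)
  finally show ?thesis .
qed

section \<open>The cube recurrence at one cube\<close>

text \<open>
  Multiplication by \<open>f100 f010 f001 / (f000\<^sup>2 f011 f101 f110)\<close> turns the three summands of the
  cube recurrence into the pairwise products of the conductances, and its left side into each of
  the three ratios, which therefore coincide for every choice of the eight values.
\<close>

lemma cube_recurrence_iff_Y_Delta: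
  fixes f000 f100 f010 f001 f011 f101 f110 f111 :: "'a :: field"
  assumes "f000 \<noteq> 0" "f100 \<noteq> 0" "f010 \<noteq> 0" "f001 \<noteq> 0"
    "f011 \<noteq> 0" "f101 \<noteq> 0" "f110 \<noteq> 0" "f111 \<noteq> 0"
  defines "A \<equiv> (f010 * f001) / (f000 * f011)"
    and "B \<equiv> (f100 * f001) / (f000 * f101)"
    and "C \<equiv> (f100 * f010) / (f000 * f110)"
    and "A' \<equiv> (f110 * f101) / (f100 * f111)"
    and "B' \<equiv> (f110 * f011) / (f010 * f111)"
    and "C' \<equiv> (f101 * f011) / (f001 * f111)"
  shows "f000 * f111 = f100 * f011 + f010 * f101 + f001 * f110 \<longleftrightarrow>
    A * (1 / A') = A * B + A * C + B * C \<and>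
    B * (1 / B') = A * B + A * C + B * C \<and>
    C * (1 / C') = A * B + A * C + B * C"
proof -
  define t where "t = f100 * f010 * f001 / (f000 * f000 * f011 * f101 * f110)"
  have "t \<noteq> 0"
    using assms by (simp add: t_def)
  have ratios: "A * (1 / A') = t * (f000 * f111)" "B * (1 / B') = t * (f000 * f111)"
    "C * (1 / C') = t * (f000 * f111)"
    using assms(1-8) by (simp_all add: assms(9-14) t_def field_simps)
  have "A * B + A * C + B * C = t * (f100 * f011 + f010 * f101 + f001 * f110)"
    using assms(1-8) by (simp add: assms(9-14) t_def field_simps)
  with ratios \<open>t \<noteq> 0\<close> show ?thesis
    by simp
qed

section \<open>Functions and conductances on the octant\<close>

lemma mem_octant_iff: "(i, j, k) \<in> octant \<longleftrightarrow> i \<le> 0 \<and> j \<le> 0 \<and> k \<le> 0"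
  by (auto simp: octant_def)

lemma conductance_of_in_conductance_functions:
  assumes "\<And>x. x \<in> octant \<Longrightarrow> f x \<noteq> 0"
  shows "conductance_of f \<in> conductance_functions"
proof -
  have "conductance_of f q (i, j, k) \<noteq> 0" if "(i, j, k) \<in> octant" for q i j k
    using that by (cases q) (auto simp: conductance_of_def mem_octant_iff intro!: assms)
  moreover have "conductance_of f q \<in> extensional octant" for q
    by (simp add: conductance_of_def)
  ultimately show ?thesis
    by (auto simp: conductance_functions_def PiE_def Pi_def)
qed

lemma cube_functions_iff_Y_Delta_consistent:
  assumes "f \<in> octant \<rightarrow>\<^sub>E (- {0})"
  shows "f \<in> cube_functions \<longleftrightarrow> Y_Delta_consistent (conductance_of f)"
proof -
  have nz: "f x \<noteq> 0" if "x \<in> octant" for x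
    using assms that by auto
  have "f (i, j, k) * f (i - 1, j - 1, k - 1) =
         f (i - 1, j, k) * f (i, j - 1, k - 1)
         + f (i, j - 1, k) * f (i - 1, j, k - 1)
         + f (i, j, k - 1) * f (i - 1, j - 1, k) \<longleftrightarrow>
       (let C = conductance_of f;
          S = C Ea (i, j, k) * C Eb (i, j, k) + C Ea (i, j, k) * C Ec (i, j, k)
                + C Eb (i, j, k) * C Ec (i, j, k)
        in C Ea (i, j, k) * resistance C Ea (i - 1, j, k) = S \<and>
           C Eb (i, j, k) * resistance C Eb (i, j - 1, k) = S \<and>
           C Ec (i, j, k) * resistance C Ec (i, j, k - 1) = S)"
    if "(i, j, k) \<in> octant" for i j k
  proof -
    have oct: "i \<le> 0" "j \<le> 0" "k \<le> 0"
      using that by (simp_all add: mem_octant_iff)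
    show ?thesis
      unfolding Let_def resistance_def
      using oct
      by (subst cube_recurrence_iff_Y_Delta)
         (auto simp: conductance_of_def mem_octant_iff intro!: nz)
  qed
  then show ?thesis
    using assms by (fastforce simp: cube_functions_def Y_Delta_consistent_def Let_def)
qed

text \<open>
  After reflection, consistency makes the ratios of neighbouring conductances agree in the three
  directions, so \<open>potential\<close> integrates them.  The reciprocal is taken because \<open>C\<^sup>f\<close> has
  \<open>f(x)\<close> and the value at the opposite corner of the face in the denominator, whereas a mixed
  difference of \<open>u\<close> has these two values of \<open>u\<close> in the numerator.
\<close>

lemma conductance_of_surj:
  assumes C: "C \<in> conductance_functions" and cons: "Y_Delta_consistent C"
  shows "\<exists>f \<in> octant \<rightarrow>\<^sub>E (- {0}). conductance_of f = C"
proof -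
  define N where "N q i j k = C q (- int i, - int j, - int k)" for q i j k
  have N_nz: "N q i j k \<noteq> 0" for q i j k
    using C by (auto simp: N_def conductance_functions_def mem_octant_iff PiE_def Pi_def)
  define u where "u = potential (N Ea) (N Eb) (N Ec)"
  have u_nz: "u i j k \<noteq> 0" for i j k
    unfolding u_def by (intro potential_nonzero N_nz)
  have shift: "- int i - 1 = - int (Suc i)" for i
    by simp
  have ratio: "N Ea i j k * (1 / N Ea (Suc i) j k) = N Eb i j k * (1 / N Eb i (Suc j) k)"
    "N Ea i j k * (1 / N Ea (Suc i) j k) = N Ec i j k * (1 / N Ec i j (Suc k))" for i j k
  proof -
    have "(- int i, - int j, - int k) \<in> octant"
      by (simp add: mem_octant_iff)
    from cons [unfolded Y_Delta_consistent_def, rule_format, OF this]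
    show "N Ea i j k * (1 / N Ea (Suc i) j k) = N Eb i j k * (1 / N Eb i (Suc j) k)"
      "N Ea i j k * (1 / N Ea (Suc i) j k) = N Ec i j k * (1 / N Ec i j (Suc k))"
      by (simp_all only: prod.case Let_def resistance_def N_def shift)
  qed
  have compat: "N Ea i j k * N Eb i (Suc j) k = N Ea (Suc i) j k * N Eb i j k"
    "N Ea i j k * N Ec i j (Suc k) = N Ea (Suc i) j k * N Ec i j k" for i j k
    using ratio [of i j k] N_nz by (simp_all add: field_simps)
  have u23: "u i j k * u i (Suc j) (Suc k) = N Ea i j k * (u i (Suc j) k * u i j (Suc k))"
    and u13: "u i j k * u (Suc i) j (Suc k) = N Eb i j k * (u (Suc i) j k * u i j (Suc k))"
    and u12: "u i j k * u (Suc i) (Suc j) k = N Ec i j k * (u (Suc i) j k * u i (Suc j) k)"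
    for i j k
    unfolding u_def
    by (rule potential_mixed_23, rule potential_mixed_13, rule compat,
        rule potential_mixed_12, rule compat)
  define f where "f = (\<lambda>(i, j, k) \<in> octant. 1 / u (nat (- i)) (nat (- j)) (nat (- k)))"
  have f: "f (- int i, - int j, - int k) = 1 / u i j k" for i j k
    by (simp add: f_def mem_octant_iff)
  have on_octant: "conductance_of f q (- int i, - int j, - int k) = N q i j k" for q i j k
  proof (cases q)
    case Ea
    then show ?thesis
      using u23 [of i j k] u_nz
      by (simp add: conductance_of_def mem_octant_iff shift f field_simps del: of_nat_Suc)
  next
    case Eb
    then show ?thesis
      using u13 [of i j k] u_nz
      by (simp add: conductance_of_def mem_octant_iff shift f field_simps del: of_nat_Suc)
  next
    case Ec
    then show ?thesis
      using u12 [of i j k] u_nz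
      by (simp add: conductance_of_def mem_octant_iff shift f field_simps del: of_nat_Suc)
  qed
  have "conductance_of f q = C q" for q
  proof (rule extensionalityI)
    show "conductance_of f q \<in> extensional octant"
      by (simp add: conductance_of_def)
    show "C q \<in> extensional octant"
      using C by (auto simp: conductance_functions_def PiE_def)
    fix x assume "x \<in> octant"
    then obtain i j k where "x = (- int i, - int j, - int k)"
      by (cases x) (metis mem_octant_iff minus_equation_iff neg_0_le_iff_le nonneg_int_cases)
    then show "conductance_of f q x = C q x"
      using on_octant by (simp add: N_def)
  qed
  moreover have "f \<in> octant \<rightarrow>\<^sub>E (- {0})"
    using u_nz by (auto simp: f_def)
  ultimately show ?thesis
    by blast
qed

theorem lemma2p2: "conductance_of ` cube_functions = consistent_conductances"
proof (intro equalityI subsetI)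
  fix C assume "C \<in> conductance_of ` cube_functions"
  then obtain f where f: "f \<in> cube_functions" "C = conductance_of f"
    by blast
  then have "f \<in> octant \<rightarrow>\<^sub>E (- {0})"
    by (simp add: cube_functions_def)
  with f show "C \<in> consistent_conductances"
    using conductance_of_in_conductance_functions [of f] cube_functions_iff_Y_Delta_consistent [of f]
    by (auto simp: consistent_conductances_def)
next
  fix C assume "C \<in> consistent_conductances"
  then have C: "C \<in> conductance_functions" "Y_Delta_consistent C"
    by (simp_all add: consistent_conductances_def)
  then obtain f where "f \<in> octant \<rightarrow>\<^sub>E (- {0})" "conductance_of f = C"
    using conductance_of_surj by blast
  with C(2) show "C \<in> conductance_of ` cube_functions"
    using cube_functions_iff_Y_Delta_consistent by blast
qed

end
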